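(* Suppose that $X$ is $H$-ordered for some integer $H\ge0$. Then the number of operations made by $\textsc{Update}_{6+\varepsilon}(p)$ of Algorithm B (described in the context) is $O\big((\log\Delta/\varepsilon)\min\{k+H,|X_{t_{\rm arr}(p)}|\}\big)$.
   Context: Let $(\mathcal U,d)$ be a metric space, $X\subseteq\mathcal U$ finite, $k\ge1$ an integer. Each $p\in X$ has an arrival time $t_{\rm arr}(p)\in\mathbb N$ and a deletion time $t_{\rm del}(p)\in\mathbb N$ with $t_{\rm arr}(p)<t_{\rm del}(p)$; arrival times are pairwise distinct, and points are presented in order of arrival. The active set at time $t$ is $X_t=\{p\in X: t_{\rm arr}(p)\le t<t_{\rm del}(p)\}$. $X$ is called $H$-ordered if for every $p,q\in X$ with $t_{\rm arr}(p)<t_{\rm arr}(q)$ and $|\{x\in X: t_{\rm arr}(p)<t_{\rm arr}(x)<t_{\rm arr}(q)\}|\ge H$, we have $t_{\rm del}(p)<t_{\rm del}(q)$. Let $d_{\min},d_{\max}$ be the minimum and maximum distance between two distinct points of $X$ (assumed known), $\Delta=d_{\max}/d_{\min}$. Let $\varepsilon>0$, $\beta=\varepsilon/6$, and $\Gamma=\{(1+\beta)^i:\lfloor\log_{1+\beta}d_{\min}\rfloor\le i\le\lceil\log_{1+\beta}d_{\max}\rceil\}$. Algorithm B: for each $\gamma\in\Gamma$ it maintains a set $A^\gamma$ of attractors, a map $rep^\gamma$ assigning to each attractor a representative, and a set $R^\gamma$ of representatives (the current representatives of the attractors, plus representatives whose attractors have been removed from $A^\gamma$). Initially all are empty. $\textsc{Update}_{6+\varepsilon}(p)$,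 called at arrival of $p$: for each $\gamma\in\Gamma$: (i) remove from $A^\gamma$ and $R^\gamma$ every $x$ with $t_{\rm del}(x)\le t_{\rm arr}(p)$; (ii) let $E=\{a\in A^\gamma:d(a,p)\le2\gamma\}$; (iii) if $E=\emptyset$: add $p$ to $A^\gamma$, set $rep^\gamma(p)=p$, add $p$ to $R^\gamma$, and run $\textsc{Cleanup}(\gamma)$; (iv) otherwise let $E'=\{a\in E: t_{\rm del}(rep^\gamma(a))<t_{\rm del}(p)\}$; if $E'\ne\emptyset$, pick an arbitrary $a\in E'$, remove $rep^\gamma(a)$ from $R^\gamma$, set $rep^\gamma(a)=p$ and add $p$ to $R^\gamma$; if $E'=\emptyset$, $p$ is discarded. $\textsc{Cleanup}(\gamma)$: if $|A^\gamma|=k+2$, remove from $A^\gamma$ the attractor with minimum deletion time. Then, if $|A^\gamma|=k+1$, let $t_{\min}=\min_{a\in A^\gamma}t_{\rm del}(a)$ and remove from $R^\gamma$ all $q$ with $t_{\rm del}(q)<t_{\min}$. Operations are counted in a unit-cost model where a distance evaluation costs $O(1)$.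
   Formalization: The O-constant is uniform for ε ≤ ε₀ and Δ ≥ Δ₀, for arbitrary fixed ε₀ > 0, Δ₀ > 1 (the bound is 0 at Δ = 1 and fails as ε → ∞); it is chosen per type of points, and A, R are kept as lists sorted by deletion time. *)

theory Defs
  imports "HOL-Analysis.Abstract_Metric_Spaces"
begin

section \<open>Counting operations\<close>

text \<open>
  A computation is the set of its possible outcomes, each paired with the number of elementary
  operations spent on reaching it.  It is a set because the algorithm contains arbitrary choices.
  Operations are charged only by \<open>step\<close> and \<open>select\<close> below; one operation
  is one access to a memory cell, comparison, assignment or distance evaluation.
\<close>

type_synonym 'r comp = "('r \<times> nat) set"

definition step :: "'r \<Rightarrow> 'r comp" where
  "step x = {(x, 1)}"

definition select :: "'r list \<Rightarrow> 'r comp" where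
  "select xs = {(x, 1) | x. x \<in> set xs}"

definition bind :: "'r comp \<Rightarrow> ('r \<Rightarrow> 's comp) \<Rightarrow> 's comp"  (infixl \<open>\<bind>\<close> 54) where
  "m \<bind> f = {(y, c + c') | x y c c'. (x, c) \<in> m \<and> (y, c') \<in> f x}"

primrec filter_c :: "('b \<Rightarrow> bool comp) \<Rightarrow> 'b list \<Rightarrow> 'b list comp" where
  "filter_c P [] = step []"
| "filter_c P (x # xs) =
     P x \<bind> (\<lambda>b. filter_c P xs \<bind> (\<lambda>ys. step (if b then x # ys else ys)))"

text \<open>The part of the list behind the first failure is dropped without being visited.\<close>

primrec takeWhile_c :: "('b \<Rightarrow> bool comp) \<Rightarrow> 'b list \<Rightarrow> 'b list comp" where
  "takeWhile_c P [] = step []"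
| "takeWhile_c P (x # xs) =
     P x \<bind> (\<lambda>b. if b then takeWhile_c P xs \<bind> (\<lambda>ys. step (x # ys)) else step [])"

primrec remove_c :: "'b \<Rightarrow> 'b list \<Rightarrow> 'b list comp" where
  "remove_c q [] = step []"
| "remove_c q (x # xs) =
     step (x = q) \<bind> (\<lambda>b. if b then step xs else remove_c q xs \<bind> (\<lambda>ys. step (x # ys)))"

primrec length_c :: "'b list \<Rightarrow> nat comp" where
  "length_c [] = step 0"
| "length_c (x # xs) = length_c xs \<bind> (\<lambda>n. step (Suc n))"

text \<open>Insertion into a list that is ordered by non-increasing key.\<close>

primrec insert_c :: "('b \<Rightarrow> nat) \<Rightarrow> 'b \<Rightarrow> 'b list \<Rightarrow> 'b list comp" where
  "insert_c key q [] = step [q]"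
| "insert_c key q (x # xs) =
     step (key x < key q) \<bind>
       (\<lambda>b. if b then step (q # x # xs) else insert_c key q xs \<bind> (\<lambda>ys. step (x # ys)))"

primrec min_c :: "('b \<Rightarrow> nat) \<Rightarrow> nat \<Rightarrow> 'b list \<Rightarrow> nat comp" where
  "min_c key m [] = step m"
| "min_c key m (x # xs) =
     step (key x < m) \<bind> (\<lambda>b. min_c key (if b then key x else m) xs)"


section \<open>The input\<close>

locale timed_points = Metric_space U d
  for U :: "'a set" and d :: "'a \<Rightarrow> 'a \<Rightarrow> real" +
  fixes X :: "'a set" and t_arr t_del :: "'a \<Rightarrow> nat"
  assumes X_finite: "finite X"
    and X_subset: "X \<subseteq> U"
    and arr_less_del: "\<And>p. p \<in> X \<Longrightarrow> t_arr p < t_del p"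
    and inj_arr: "inj_on t_arr X"
begin

definition active :: "nat \<Rightarrow> 'a set" where
  "active t = {p \<in> X. t_arr p \<le> t \<and> t < t_del p}"

definition H_ordered :: "nat \<Rightarrow> bool" where
  "H_ordered H \<longleftrightarrow>
     (\<forall>p\<in>X. \<forall>q\<in>X. t_arr p < t_arr q \<longrightarrow>
        H \<le> card {x \<in> X. t_arr p < t_arr x \<and> t_arr x < t_arr q} \<longrightarrow> t_del p < t_del q)"

definition distances :: "real set" where
  "distances = {d p q | p q. p \<in> X \<and> q \<in> X \<and> p \<noteq> q}"

definition d_min :: real where "d_min = Min distances"

definition d_max :: real where "d_max = Max distances"

definition aspect_ratio :: real where "aspect_ratio = d_max / d_min"

end


section \<open>The algorithm\<close>

text \<open>
  The state for one radius guess.  The sets of attractors and of representatives are stored as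
  linked lists ordered by non-increasing deletion time.  Hence the expired points always form a
  tail of the list, and an update that removes them pays for the points that stay but not
  for those that are dropped.  With a data structure in which each expired point is paid for
  by the update that removes it, a bound by the number of currently active points is
  impossible, because all points seen so far may expire between two consecutive arrivals.
\<close>

record 'a guess_state =
  attractors :: "'a list"
  rep :: "'a \<Rightarrow> 'a"
  representatives :: "'a list"

text \<open>At least two points are needed for \<^term>\<open>timed_points.d_min\<close> to be defined.\<close>

locale algorithm_B = timed_points U d X t_arr t_del
  for U :: "'a set" and d :: "'a \<Rightarrow> 'a \<Rightarrow> real" and X :: "'a set" and t_arr t_del :: "'a \<Rightarrow> nat" +
  fixes k :: nat and \<epsilon> :: real
  assumes two_points: "2 \<le> card X"
    and k_pos: "1 \<le> k"
    and eps_pos: "0 < \<epsilon>"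
begin

definition \<beta> :: real where "\<beta> = \<epsilon> / 6"

definition \<Gamma> :: "real set" where
  "\<Gamma> = {(1 + \<beta>) powi i | i. \<lfloor>log (1 + \<beta>) d_min\<rfloor> \<le> i \<and> i \<le> \<lceil>log (1 + \<beta>) d_max\<rceil>}"

definition cleanup :: "'a list \<Rightarrow> 'a list \<Rightarrow> ('a list \<times> 'a list) comp" where
  "cleanup A R =
     length_c A \<bind> (\<lambda>n.
     (if n = k + 2
      then min_c t_del (t_del (hd A)) A \<bind> (\<lambda>t.
           filter_c (\<lambda>a. step (t_del a = t)) A \<bind> (\<lambda>M.
           select M \<bind> (\<lambda>a.
           remove_c a A)))
      else step A) \<bind> (\<lambda>A'.
     length_c A' \<bind> (\<lambda>n'.
     (if n' = k + 1
      then min_c t_del (t_del (hd A')) A' \<bind> (\<lambda>t_min.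
           filter_c (\<lambda>q. step (\<not> t_del q < t_min)) R)
      else step R) \<bind> (\<lambda>R'.
     step (A', R')))))"

definition update_guess :: "'a \<Rightarrow> real \<Rightarrow> 'a guess_state \<Rightarrow> 'a guess_state comp" where
  "update_guess p \<gamma> s =
     takeWhile_c (\<lambda>x. step (t_arr p < t_del x)) (attractors s) \<bind> (\<lambda>A.
     takeWhile_c (\<lambda>x. step (t_arr p < t_del x)) (representatives s) \<bind> (\<lambda>R.
     filter_c (\<lambda>a. step (d a p) \<bind> (\<lambda>r. step (r \<le> 2 * \<gamma>))) A \<bind> (\<lambda>E.
     step (E = []) \<bind> (\<lambda>E_empty.
     if E_empty
     then insert_c t_del p A \<bind> (\<lambda>A'.
          step ((rep s)(p := p)) \<bind> (\<lambda>rep'.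
          insert_c t_del p R \<bind> (\<lambda>R'.
          cleanup A' R' \<bind> (\<lambda>(A'', R'').
          step \<lparr>attractors = A'', rep = rep', representatives = R''\<rparr>))))
     else filter_c (\<lambda>a. step (rep s a) \<bind> (\<lambda>r. step (t_del r < t_del p))) E \<bind> (\<lambda>E'.
          step (E' = []) \<bind> (\<lambda>E'_empty.
          if E'_empty
          then step \<lparr>attractors = A, rep = rep s, representatives = R\<rparr>
          else select E' \<bind> (\<lambda>a.
               step (rep s a) \<bind> (\<lambda>r.
               remove_c r R \<bind> (\<lambda>R'.
               step ((rep s)(a := p)) \<bind> (\<lambda>rep'.
               insert_c t_del p R' \<bind> (\<lambda>R''.
               step \<lparr>attractors = A, rep = rep', representatives = R''\<rparr>)))))))))))"

primrec update_guesses ::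
  "'a \<Rightarrow> real list \<Rightarrow> (real \<Rightarrow> 'a guess_state) \<Rightarrow> (real \<Rightarrow> 'a guess_state) comp" where
  "update_guesses p [] \<sigma> = step \<sigma>"
| "update_guesses p (\<gamma> # \<gamma>s) \<sigma> =
     step (\<sigma> \<gamma>) \<bind> (\<lambda>s.
     update_guess p \<gamma> s \<bind> (\<lambda>s'.
     step (\<sigma>(\<gamma> := s')) \<bind> (\<lambda>\<sigma>'.
     update_guesses p \<gamma>s \<sigma>')))"

definition update :: "'a \<Rightarrow> (real \<Rightarrow> 'a guess_state) \<Rightarrow> (real \<Rightarrow> 'a guess_state) comp" where
  "update p \<sigma> = update_guesses p (sorted_list_of_set \<Gamma>) \<sigma>"

definition initial :: "real \<Rightarrow> 'a guess_state" where
  "initial \<gamma> = \<lparr>attractors = [], rep = (\<lambda>_. undefined), representatives = []\<rparr>"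

text \<open>\<open>run Q \<sigma>\<close>: the algorithm can be in state \<open>\<sigma>\<close> after processing exactly the points of \<open>Q\<close>.\<close>

inductive run :: "'a set \<Rightarrow> (real \<Rightarrow> 'a guess_state) \<Rightarrow> bool" where
  run_init: "run {} initial"
| run_update: "run Q \<sigma> \<Longrightarrow> p \<in> X - Q \<Longrightarrow> (\<forall>q\<in>X - Q. t_arr p \<le> t_arr q) \<Longrightarrow>
    (\<sigma>', c) \<in> update p \<sigma> \<Longrightarrow> run (insert p Q) \<sigma>'"

end


section \<open>The lists implement the sets\<close>

text \<open>
  The set-level description of the algorithm, as the set of possible results.  The lemmas
  of this section show that one update of the lists realises exactly the updates of the
  sets, and that an update never gets stuck.  They are not used in the definitions above.
\<close>

context algorithm_B
begin

definition Cleanup :: "'a set \<Rightarrow> 'a set \<Rightarrow> ('a set \<times> 'a set) set" where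
  "Cleanup A R =
     (\<Union>A' \<in> (if card A = k + 2 then {A - {a} | a. a \<in> A \<and> (\<forall>b\<in>A. t_del a \<le> t_del b)} else {A}).
       {(A', if card A' = k + 1 then R - {q. t_del q < Min (t_del ` A')} else R)})"

definition Update ::
  "'a \<Rightarrow> real \<Rightarrow> 'a set \<times> ('a \<Rightarrow> 'a) \<times> 'a set \<Rightarrow> ('a set \<times> ('a \<Rightarrow> 'a) \<times> 'a set) set" where
  "Update p \<gamma> = (\<lambda>(A\<^sub>0, \<rho>, R\<^sub>0).
     let A = A\<^sub>0 - {x. t_del x \<le> t_arr p};
         R = R\<^sub>0 - {x. t_del x \<le> t_arr p};
         E = {a \<in> A. d a p \<le> 2 * \<gamma>};
         E' = {a \<in> E. t_del (\<rho> a) < t_del p}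
     in if E = {} then {(A', \<rho>(p := p), R') | A' R'. (A', R') \<in> Cleanup (insert p A) (insert p R)}
        else if E' = {} then {(A, \<rho>, R)}
        else {(A, \<rho>(a := p), insert p (R - {\<rho> a})) | a. a \<in> E'})"

definition set_state :: "'a guess_state \<Rightarrow> 'a set \<times> ('a \<Rightarrow> 'a) \<times> 'a set" where
  "set_state s = (set (attractors s), rep s, set (representatives s))"

definition ordered_list :: "'a set \<Rightarrow> 'a list \<Rightarrow> bool" where
  "ordered_list Q xs \<longleftrightarrow> set xs \<subseteq> Q \<and> distinct xs \<and> sorted_wrt (\<lambda>x y. t_del y \<le> t_del x) xs"

definition ordered_state :: "'a set \<Rightarrow> 'a guess_state \<Rightarrow> bool" where
  "ordered_state Q s \<longleftrightarrow> ordered_list Q (attractors s) \<and> ordered_list Q (representatives s)"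

end

definition results :: "'r comp \<Rightarrow> 'r set" where
  "results m = fst ` m"

lemma results_step [simp]: "results (step x) = {x}"
  by (simp add: results_def step_def)

lemma results_select [simp]: "results (select xs) = set xs"
  by (force simp: results_def select_def)

lemma results_bind [simp]: "results (m \<bind> f) = (\<Union>x\<in>results m. results (f x))"
  by (force simp: results_def bind_def image_iff)

lemma results_filter_c:
  "(\<And>x. results (P x) = {Q x}) \<Longrightarrow> results (filter_c P xs) = {filter Q xs}"
  by (induction xs) auto

lemma results_takeWhile_c:
  "(\<And>x. results (P x) = {Q x}) \<Longrightarrow> results (takeWhile_c P xs) = {takeWhile Q xs}"
  by (induction xs) auto

lemma results_remove_c: "results (remove_c q xs) = {remove1 q xs}"
  by (induction xs) auto

lemma results_length_c: "results (length_c xs) = {length xs}"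
  by (induction xs) auto

lemma Collect_pair_image: "{h x y | x y. (x, y) \<in> S} = (\<lambda>(x, y). h x y) ` S"
  by auto

primrec insert_desc :: "('b \<Rightarrow> nat) \<Rightarrow> 'b \<Rightarrow> 'b list \<Rightarrow> 'b list" where
  "insert_desc key q [] = [q]"
| "insert_desc key q (x # xs) = (if key x < key q then q # x # xs else x # insert_desc key q xs)"

lemma results_insert_c: "results (insert_c key q xs) = {insert_desc key q xs}"
  by (induction xs) auto

lemma results_min_c: "results (min_c key m xs) = {Min (insert m (key ` set xs))}"
proof (induction xs arbitrary: m)
  case (Cons x xs)
  have m: "(if key x < m then key x else m) = min m (key x)"
    by (simp add: min_def)
  have "Min (insert (min m (key x)) (key ` set xs)) = Min (insert m (key ` set (x # xs)))"
    by (cases "xs = []") (simp_all add: min.assoc)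
  with m show ?case by (simp add: Cons.IH)
qed auto

lemma results_min_c_hd: "xs \<noteq> [] \<Longrightarrow> results (min_c key (key (hd xs)) xs) = {Min (key ` set xs)}"
  by (simp add: results_min_c insert_absorb)

lemma set_insert_desc [simp]: "set (insert_desc key q xs) = insert q (set xs)"
  by (induction xs) auto

lemma takeWhile_desc:
  "sorted_wrt (\<lambda>x y. key y \<le> key x) xs \<Longrightarrow>
   takeWhile (\<lambda>x. t < key x) xs = filter (\<lambda>x. t < (key x :: nat)) xs"
proof (induction xs)
  case (Cons x xs)
  then have "\<not> t < key x \<Longrightarrow> filter (\<lambda>x. t < key x) xs = []"
    by (fastforce simp: filter_empty_conv)
  with Cons show ?case by auto
qed simp

context algorithm_B
begin

lemma ordered_list_filter: "ordered_list Q xs \<Longrightarrow> ordered_list Q (filter P xs)"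
  by (auto simp: ordered_list_def intro: sorted_wrt_filter)

lemma ordered_list_remove1: "ordered_list Q xs \<Longrightarrow> ordered_list Q (remove1 q xs)"
  using ordered_list_filter[of Q xs "\<lambda>x. q \<noteq> x"]
  by (simp add: ordered_list_def distinct_remove1_removeAll removeAll_filter_not_eq)

lemma ordered_list_insert_desc:
  assumes "ordered_list Q xs" "q \<notin> Q"
  shows "ordered_list (insert q Q) (insert_desc t_del q xs)"
proof -
  have "q \<notin> set xs" using assms by (auto simp: ordered_list_def)
  moreover have "distinct xs" "sorted_wrt (\<lambda>x y. t_del y \<le> t_del x) xs" "set xs \<subseteq> Q"
    using assms by (auto simp: ordered_list_def)
  ultimately have "distinct (insert_desc t_del q xs)
    \<and> sorted_wrt (\<lambda>x y. t_del y \<le> t_del x) (insert_desc t_del q xs)"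
    by (induction xs) fastforce+
  with \<open>set xs \<subseteq> Q\<close> show ?thesis by (auto simp: ordered_list_def)
qed

lemma ordered_list_mono: "ordered_list Q xs \<Longrightarrow> Q \<subseteq> Q' \<Longrightarrow> ordered_list Q' xs"
  by (auto simp: ordered_list_def)

lemma cleanup_set:
  assumes "ordered_list Q A" "ordered_list Q R"
  shows "(\<lambda>(A, R). (set A, set R)) ` results (cleanup A R) = Cleanup (set A) (set R)"
    and "\<And>A' R'. (A', R') \<in> results (cleanup A R) \<Longrightarrow> ordered_list Q A' \<and> ordered_list Q R'"
proof -
  define As where "As = (if length A = k + 2
    then {remove1 a A | a. a \<in> set A \<and> t_del a = Min (t_del ` set A)} else {A})"
  define f where "f A' = (if length A' = k + 1
    then filter (\<lambda>q. \<not> t_del q < Min (t_del ` set A')) R else R)" for A'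
  have ne: "A' \<noteq> []" if "length A' = Suc n" for A' :: "'a list" and n
    using that by auto
  define del_min where "del_min = min_c t_del (t_del (hd A)) A \<bind> (\<lambda>t.
    filter_c (\<lambda>a. step (t_del a = t)) A \<bind> (\<lambda>M. select M \<bind> (\<lambda>a. remove_c a A)))"
  define prune where "prune A' = min_c t_del (t_del (hd A')) A' \<bind>
    (\<lambda>t_min. filter_c (\<lambda>q. step (\<not> t_del q < t_min)) R)" for A'
  have "results (filter_c (\<lambda>q. step (\<not> t_del q < t)) R) = {filter (\<lambda>q. \<not> t_del q < t) R}" for t
    by (rule results_filter_c) simp
  then have f: "results (if length A' = k + 1 then prune A' else step R) = {f A'}" for A'
    using ne[of A' k] by (simp add: f_def prune_def results_min_c_hd del: Min_gr_iff Min_less_iff not_less)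
  have "results (filter_c (\<lambda>a. step (t_del a = t)) A) = {filter (\<lambda>a. t_del a = t) A}" for t
    by (rule results_filter_c) simp
  then have A: "results (if length A = k + 2 then del_min else step A) = As"
    using ne[of A "Suc k"] by (auto simp: As_def del_min_def results_min_c_hd results_remove_c)
  have res: "results (cleanup A R) = (\<lambda>A'. (A', f A')) ` As"
    unfolding cleanup_def del_min_def[symmetric] prune_def[symmetric]
      results_bind results_length_c results_step
    unfolding UN_insert UN_empty Un_empty_right A f by auto
  have ord: "ordered_list Q A'" if "A' \<in> As" for A'
    using that assms(1) ordered_list_remove1 by (auto simp: As_def split: if_splits)
  show "ordered_list Q A' \<and> ordered_list Q R'" if "(A', R') \<in> results (cleanup A R)" for A' R'
    using that ord assms(2) ordered_list_filter unfolding res f_def by (auto split: if_splits)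
  have card_eq: "card (set A') = length A'" if "ordered_list Q A'" for A'
    using that distinct_card by (auto simp: ordered_list_def)
  have setf: "set (f A') = (if card (set A') = k + 1
      then set R - {q. t_del q < Min (t_del ` set A')} else set R)" if "A' \<in> As" for A'
    using card_eq[OF ord[OF that]] by (auto simp: f_def)
  have min_iff: "t_del a = Min (t_del ` set A) \<longleftrightarrow> (\<forall>b\<in>set A. t_del a \<le> t_del b)"
    if "a \<in> set A" for a
    using that by (auto intro: Min_eqI[symmetric])
  have "set ` As = (if card (set A) = k + 2
      then {set A - {a} | a. a \<in> set A \<and> (\<forall>b\<in>set A. t_del a \<le> t_del b)} else {set A})"
  proof (cases "length A = k + 2")
    case True
    have "set (remove1 a A) = set A - {a}" for a
      using assms(1) by (auto simp: ordered_list_def)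
    then have "set ` As = {set A - {a} | a. a \<in> set A \<and> t_del a = Min (t_del ` set A)}"
      using True by (fastforce simp: As_def image_iff)
    also have "\<dots> = {set A - {a} | a. a \<in> set A \<and> (\<forall>b\<in>set A. t_del a \<le> t_del b)}"
      using min_iff by blast
    finally show ?thesis using True card_eq[OF assms(1)] by simp
  qed (use card_eq[OF assms(1)] in \<open>simp add: As_def\<close>)
  then have "Cleanup (set A) (set R) = (\<Union>S\<in>set ` As.
      {(S, if card S = k + 1 then set R - {q. t_del q < Min (t_del ` S)} else set R)})"
    unfolding Cleanup_def by simp
  also have "\<dots> = (\<Union>A'\<in>As. {(set A', set (f A'))})"
    using setf by simp
  finally have "Cleanup (set A) (set R) = (\<Union>A'\<in>As. {(set A', set (f A'))})" .
  then show "(\<lambda>(A, R). (set A, set R)) ` results (cleanup A R) = Cleanup (set A) (set R)"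
    unfolding res by auto
qed

theorem update_guess_set:
  assumes "ordered_state Q s" "p \<notin> Q"
  shows "set_state ` results (update_guess p \<gamma> s) = Update p \<gamma> (set_state s)"
    and "\<And>s'. s' \<in> results (update_guess p \<gamma> s) \<Longrightarrow> ordered_state (insert p Q) s'"
proof -
  define A where "A = filter (\<lambda>x. t_arr p < t_del x) (attractors s)"
  define R where "R = filter (\<lambda>x. t_arr p < t_del x) (representatives s)"
  define E where "E = filter (\<lambda>a. d a p \<le> 2 * \<gamma>) A"
  define E' where "E' = filter (\<lambda>a. t_del (rep s a) < t_del p) E"
  have ordA: "ordered_list Q A" and ordR: "ordered_list Q R"
    using assms(1) by (auto simp: A_def R_def ordered_state_def intro: ordered_list_filter)
  have sets: "set A = set (attractors s) - {x. t_del x \<le> t_arr p}"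
    "set R = set (representatives s) - {x. t_del x \<le> t_arr p}"
    "set E = {a \<in> set A. d a p \<le> 2 * \<gamma>}" "set E' = {a \<in> set E. t_del (rep s a) < t_del p}"
    by (auto simp: A_def R_def E_def E'_def)
  have tw: "results (takeWhile_c (\<lambda>x. step (t_arr p < t_del x)) (attractors s)) = {A}"
    "results (takeWhile_c (\<lambda>x. step (t_arr p < t_del x)) (representatives s)) = {R}"
    using assms(1)
    by (simp_all add: A_def R_def results_takeWhile_c[where Q = "\<lambda>x. t_arr p < t_del x"]
        takeWhile_desc ordered_state_def ordered_list_def)
  have E: "results (filter_c (\<lambda>a. step (d a p) \<bind> (\<lambda>r. step (r \<le> 2 * \<gamma>))) A) = {E}"
    unfolding E_def by (rule results_filter_c) simp
  have E': "results (filter_c (\<lambda>a. step (rep s a) \<bind> (\<lambda>r. step (t_del r < t_del p))) E) = {E'}"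
    unfolding E'_def by (rule results_filter_c) simp
  let ?A = "insert_desc t_del p A" and ?R = "insert_desc t_del p R"
  have res: "results (update_guess p \<gamma> s) =
    (if E = [] then {\<lparr>attractors = A'', rep = (rep s)(p := p), representatives = R''\<rparr> | A'' R''.
          (A'', R'') \<in> results (cleanup ?A ?R)}
     else if E' = [] then {\<lparr>attractors = A, rep = rep s, representatives = R\<rparr>}
     else {\<lparr>attractors = A, rep = (rep s)(a := p),
            representatives = insert_desc t_del p (remove1 (rep s a) R)\<rparr> | a. a \<in> set E'})"
  proof (cases "E = []")
    case True
    then show ?thesis
      unfolding update_guess_def by (auto simp: tw E results_insert_c)
  next
    case False
    then show ?thesis
      unfolding update_guess_def
      by (cases "E' = []") (auto simp: tw E E' results_insert_c results_remove_c)
  qed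
  have ord: "ordered_list (insert p Q) ?A" "ordered_list (insert p Q) ?R"
    using ordA ordR assms(2) by (simp_all add: ordered_list_insert_desc)
  show "ordered_state (insert p Q) s'" if s': "s' \<in> results (update_guess p \<gamma> s)" for s'
  proof -
    consider A'' R'' where "(A'', R'') \<in> results (cleanup ?A ?R)"
        "attractors s' = A''" "representatives s' = R''"
      | "attractors s' = A" "representatives s' = R"
      | a where "attractors s' = A"
        "representatives s' = insert_desc t_del p (remove1 (rep s a) R)"
      using s' unfolding res by (auto split: if_splits)
    then show ?thesis
    proof cases
      case 1
      then show ?thesis using cleanup_set(2)[OF ord] by (simp add: ordered_state_def)
    next
      case 2
      then show ?thesis using ordA ordR ordered_list_mono unfolding ordered_state_def by blast
    next
      case (3 a)
      then show ?thesis
        using ordered_list_mono[OF ordA, of "insert p Q"]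
          ordered_list_insert_desc[OF ordered_list_remove1[OF ordR] assms(2)]
        unfolding ordered_state_def by auto
    qed
  qed
  have cl: "Cleanup (insert p (set A)) (insert p (set R))
      = (\<lambda>(A, R). (set A, set R)) ` results (cleanup ?A ?R)"
    using cleanup_set(1)[OF ord] by simp
  have rem: "set (remove1 q R) = set R - {q}" for q
    using ordR by (auto simp: ordered_list_def)
  have spec: "Update p \<gamma> (set_state s) =
    (if E = [] then {(A', (rep s)(p := p), R') | A' R'.
        (A', R') \<in> Cleanup (insert p (set A)) (insert p (set R))}
     else if E' = [] then {(set A, rep s, set R)}
     else {(set A, (rep s)(a := p), insert p (set R - {rep s a})) | a. a \<in> set E'})"
    unfolding Update_def set_state_def Let_def prod.case
    unfolding sets(1)[symmetric] sets(2)[symmetric] unfolding sets(3)[symmetric]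
    unfolding sets(4)[symmetric] by simp
  show "set_state ` results (update_guess p \<gamma> s) = Update p \<gamma> (set_state s)"
  proof -
    consider "E = []" | "E \<noteq> []" "E' = []" | "E \<noteq> []" "E' \<noteq> []" by blast
    then show ?thesis
    proof cases
      case 1
      then show ?thesis 
        unfolding res spec cl if_P[OF 1] Collect_pair_image
        by (simp add: image_image set_state_def case_prod_beta)
    next
      case 2
      then show ?thesis unfolding res spec by (simp add: set_state_def)
    next
      case 3
      then show ?thesis 
        unfolding res spec image_Collect by (simp add: set_state_def rem setcompr_eq_image image_image)
    qed
  qed
qed

lemma update_guess_total:
  assumes "ordered_state Q s" "p \<notin> Q"
  shows "update_guess p \<gamma> s \<noteq> {}"
proof -
  have "Cleanup A R \<noteq> {}" if "finite A" for A R
  proof -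
    have "\<exists>a\<in>A. \<forall>b\<in>A. t_del a \<le> t_del b" if "card A = k + 2"
      using that \<open>finite A\<close> ex_min_if_finite[of "t_del ` A"]
      by (metis add_is_0 arg_min_if_finite(1) arg_min_least card.empty zero_neq_numeral)
    then show ?thesis by (auto simp: Cleanup_def)
  qed
  then have "\<exists>A' R'. (A', R') \<in> Cleanup A R" if "finite A" for A R
    using that by fastforce
  then have "Update p \<gamma> (set_state s) \<noteq> {}"
    by (simp add: Update_def set_state_def Let_def)
  then show ?thesis
    using update_guess_set(1)[OF assms, of \<gamma>] by (auto simp: results_def)
qed

lemma update_guesses_ordered:
  assumes "\<forall>\<gamma>. ordered_state (insert p Q) (\<sigma> \<gamma>)" "\<forall>\<gamma>\<in>set \<gamma>s. ordered_state Q (\<sigma> \<gamma>)"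
    "p \<notin> Q" "distinct \<gamma>s"
  shows "update_guesses p \<gamma>s \<sigma> \<noteq> {}"
    and "(\<sigma>', c) \<in> update_guesses p \<gamma>s \<sigma> \<Longrightarrow> ordered_state (insert p Q) (\<sigma>' \<gamma>)"
  using assms
proof (induction \<gamma>s arbitrary: \<sigma> c)
  case Nil
  { case 1 then show ?case by (simp add: step_def) }
  { case 2 then show ?case by (simp add: step_def) }
next
  case (Cons g \<gamma>s)
  have inv: "(\<forall>\<gamma>. ordered_state (insert p Q) ((\<sigma>(g := s')) \<gamma>)) \<and>
      (\<forall>\<gamma>\<in>set \<gamma>s. ordered_state Q ((\<sigma>(g := s')) \<gamma>))"
    if "(s', c') \<in> update_guess p g (\<sigma> g)" "\<forall>\<gamma>. ordered_state (insert p Q) (\<sigma> \<gamma>)"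
      "\<forall>\<gamma>\<in>set (g # \<gamma>s). ordered_state Q (\<sigma> \<gamma>)" "distinct (g # \<gamma>s)" "p \<notin> Q" for s' c' \<sigma>
    using that update_guess_set(2)[of Q "\<sigma> g" p s' g] by (force simp: results_def)
  { case (1 \<sigma>)
    then obtain s' c' where s': "(s', c') \<in> update_guess p g (\<sigma> g)"
      using update_guess_total[of Q "\<sigma> g" p g] by fastforce
    have "update_guesses p \<gamma>s (\<sigma>(g := s')) \<noteq> {}"
      using Cons.IH(1)[of "\<sigma>(g := s')"] inv[where \<sigma> = \<sigma>, OF s'] 1
      by (simp del: fun_upd_apply)
    then show ?case using s' by (fastforce simp: bind_def step_def) }
  { case (2 \<sigma> c)
    then obtain s' c' c'' where s': "(s', c') \<in> update_guess p g (\<sigma> g)"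
      and "(\<sigma>', c'') \<in> update_guesses p \<gamma>s (\<sigma>(g := s'))"
      by (auto simp: bind_def step_def)
    then show ?case using Cons.IH(2)[of c'' "\<sigma>(g := s')"] inv[where \<sigma> = \<sigma>, OF s'] 2
      by (simp del: fun_upd_apply) }
qed

lemma run_ordered: "run Q \<sigma> \<Longrightarrow> ordered_state Q (\<sigma> \<gamma>)"
proof (induction arbitrary: \<gamma> rule: run.induct)
  case run_init
  then show ?case by (simp add: initial_def ordered_state_def ordered_list_def)
next
  case (run_update Q \<sigma> p \<sigma>' c)
  then have "ordered_state (insert p Q) (\<sigma> \<gamma>)" for \<gamma>
    using ordered_list_mono[of Q _ "insert p Q"] by (force simp: ordered_state_def)
  then show ?case
    using update_guesses_ordered(2)[of p Q \<sigma> "sorted_list_of_set \<Gamma>" \<sigma>' c] run_update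
    unfolding update_def by simp
qed

theorem run_update_guess_set:
  assumes "run Q \<sigma>" "p \<notin> Q"
  shows "set_state ` results (update_guess p \<gamma> (\<sigma> \<gamma>)) = Update p \<gamma> (set_state (\<sigma> \<gamma>))"
  using update_guess_set(1) run_ordered assms by blast

theorem run_exists:
  assumes "p \<in> X"
  shows "\<exists>\<sigma>. run {q \<in> X. t_arr q < t_arr p} \<sigma>"
proof -
  have "\<exists>\<sigma>. run {q \<in> X. t_arr q < t} \<sigma>" for t
  proof (induction t)
    case 0
    then show ?case using run_init by auto
  next
    case (Suc t)
    then obtain \<sigma> where \<sigma>: "run {q \<in> X. t_arr q < t} \<sigma>" by blast
    show ?case
    proof (cases "\<exists>p\<in>X. t_arr p = t")
      case True
      then obtain p where p: "p \<in> X" "t_arr p = t" by blast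
      then have eq: "{q \<in> X. t_arr q < Suc t} = insert p {q \<in> X. t_arr q < t}"
        using inj_arr by (auto simp: less_Suc_eq inj_on_def)
      have "ordered_state (insert p {q \<in> X. t_arr q < t}) (\<sigma> \<gamma>)" for \<gamma>
        using run_ordered[OF \<sigma>, of \<gamma>] ordered_list_mono
        unfolding ordered_state_def by (metis subset_insertI)
      then have "update p \<sigma> \<noteq> {}"
        using update_guesses_ordered(1)[of p "{q \<in> X. t_arr q < t}"] run_ordered[OF \<sigma>] p
        unfolding update_def by simp
      then obtain \<sigma>' c where "(\<sigma>', c) \<in> update p \<sigma>" by fastforce
      then have "run (insert p {q \<in> X. t_arr q < t}) \<sigma>'"
        using run_update[OF \<sigma>, of p \<sigma>' c] p by (auto simp: not_less)
      then show ?thesis using eq by auto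
    next
      case False
      then have "{q \<in> X. t_arr q < Suc t} = {q \<in> X. t_arr q < t}"
        by (auto simp: less_Suc_eq)
      then show ?thesis using \<sigma> by auto
    qed
  qed
  then show ?thesis by blast
qed

end

end

theory Submission
  imports Defs
begin

text \<open>
  For one guess, an update costs a constant times the number of stored points that have not
  expired.  These points are active, so it remains to bound the representatives by \<open>O(k + H)\<close>.
  When an attractor \<open>a\<close> disappears, by expiry or by a cleanup, every representative that stays is
  deleted no earlier than \<open>a\<close>, so at most \<open>H\<close> of those that arrived before \<open>a\<close> can stay.
  Taking for \<open>a\<close> the last arrived attractor that left a representative behind, every
  representative that arrived after \<open>a\<close> belongs either to a stored attractor or to one of the
  at most \<open>k + 2\<close> attractors that were stored when \<open>a\<close> arrived.
\<close>

section \<open>Costs of the list operations\<close>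

text \<open>The bound covers every outcome, because the choices of the algorithm are arbitrary. It
  holds vacuously for a computation without outcomes.\<close>

definition cost_le :: "'r comp \<Rightarrow> nat \<Rightarrow> bool" where
  "cost_le m n \<longleftrightarrow> (\<forall>(y, c) \<in> m. c \<le> n)"

lemma cost_le_step [simp]: "cost_le (step x) n \<longleftrightarrow> 1 \<le> n"
  by (simp add: cost_le_def step_def)

lemma cost_le_select: "cost_le (select xs) 1"
  by (auto simp: cost_le_def select_def)

text \<open>The continuation is bounded only on \<open>results m\<close>; this lets the lengths of
  intermediate lists enter the estimates.\<close>

lemma cost_le_bind:
  assumes "cost_le m a" "\<And>y. y \<in> results m \<Longrightarrow> cost_le (f y) b" "a + b \<le> n"
  shows "cost_le (m \<bind> f) n"
  unfolding cost_le_def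
proof clarify
  fix y c
  assume "(y, c) \<in> m \<bind> f"
  then obtain x c1 c2 where x: "(x, c1) \<in> m" "(y, c2) \<in> f x" "c = c1 + c2"
    by (auto simp: bind_def)
  then have "x \<in> results m" by (force simp: results_def)
  then have "c2 \<le> b" using assms(2) x by (auto simp: cost_le_def)
  moreover have "c1 \<le> a" using assms(1) x by (auto simp: cost_le_def)
  ultimately show "c \<le> n" using x assms(3) by simp
qed

lemma cost_le_mono: "cost_le m a \<Longrightarrow> a \<le> b \<Longrightarrow> cost_le m b"
  by (fastforce simp: cost_le_def)

lemma cost_le_step_bind: "cost_le (f x) b \<Longrightarrow> Suc b \<le> n \<Longrightarrow> cost_le (step x \<bind> f) n"
  by (rule cost_le_bind[where a = 1 and b = b]) auto

lemma cost_le_filter_c: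
  assumes "\<And>x. cost_le (P x) n"
  shows "cost_le (filter_c P xs) ((n + 1) * length xs + 1)"
proof (induction xs)
  case (Cons x xs)
  then have "cost_le (filter_c P xs \<bind> (\<lambda>ys. step (if b then x # ys else ys)))
      ((n + 1) * length xs + 2)" for b
    by (rule cost_le_bind[where b = 1]) auto
  then show ?case
    by (simp, intro cost_le_bind[OF assms]) auto
qed simp

text \<open>Each kept element pays for its test and its cons; the first failure pays for a test and
  a final step, whence the 2. The dropped tail is free, so expired points are not charged
  individually.\<close>

lemma cost_le_takeWhile_c:
  "cost_le (takeWhile_c (\<lambda>x. step (Q x)) xs) (2 * length (takeWhile Q xs) + 2)"
proof (induction xs)
  case (Cons x xs)
  then have "cost_le (takeWhile_c (\<lambda>x. step (Q x)) xs \<bind> (\<lambda>ys. step (x # ys)))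
      (2 * length (takeWhile Q xs) + 3)"
    by (rule cost_le_bind[where b = 1]) auto
  then show ?case
    by (auto intro!: cost_le_step_bind)
qed simp

lemma cost_le_remove_c: "cost_le (remove_c q xs) (2 * length xs + 1)"
proof (induction xs)
  case (Cons x xs)
  then have "cost_le (remove_c q xs \<bind> (\<lambda>ys. step (x # ys))) (2 * length xs + 2)"
    by (rule cost_le_bind[where b = 1]) auto
  then show ?case
    by (auto intro!: cost_le_step_bind[where b = "2 * length xs + 2"])
qed simp

lemma cost_le_insert_c: "cost_le (insert_c key q xs) (2 * length xs + 1)"
proof (induction xs)
  case (Cons x xs)
  then have "cost_le (insert_c key q xs \<bind> (\<lambda>ys. step (x # ys))) (2 * length xs + 2)"
    by (rule cost_le_bind[where b = 1]) auto
  then show ?case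
    by (auto intro!: cost_le_step_bind[where b = "2 * length xs + 2"])
qed simp

lemma cost_le_length_c: "cost_le (length_c xs) (length xs + 1)"
  by (induction xs) (auto intro!: cost_le_bind[where b = 1])

lemma cost_le_min_c: "cost_le (min_c key m xs) (length xs + 1)"
  by (induction xs arbitrary: m) (auto intro!: cost_le_step_bind)

lemma length_insert_desc [simp]: "length (insert_desc key q xs) = Suc (length xs)"
  by (induction xs) auto

section \<open>Cost of one update in terms of the unexpired stored points\<close>

context algorithm_B
begin

lemma cost_le_cleanup: "cost_le (cleanup A R) (8 * length A + 2 * length R + 10)"
proof -
  let ?n = "length A"
  have 1: "cost_le (if n = k + 2
      then min_c t_del (t_del (hd A)) A \<bind> (\<lambda>t.
           filter_c (\<lambda>a. step (t_del a = t)) A \<bind> (\<lambda>M.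
           select M \<bind> (\<lambda>a.
           remove_c a A)))
      else step A) (5 * ?n + 4)" for n
  proof -
    have "cost_le (select M \<bind> (\<lambda>a. remove_c a A)) (2 * ?n + 2)" for M
      by (rule cost_le_bind[OF cost_le_select cost_le_remove_c]) simp
    then have "cost_le (filter_c (\<lambda>a. step (t_del a = t)) A \<bind> (\<lambda>M.
           select M \<bind> (\<lambda>a. remove_c a A))) (4 * ?n + 3)" for t
      by (intro cost_le_bind[OF cost_le_filter_c[where n = 1]]) auto
    then have "cost_le (min_c t_del (t_del (hd A)) A \<bind> (\<lambda>t.
           filter_c (\<lambda>a. step (t_del a = t)) A \<bind> (\<lambda>M.
           select M \<bind> (\<lambda>a. remove_c a A)))) (5 * ?n + 4)"
      by (rule cost_le_bind[OF cost_le_min_c]) simp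
    then show ?thesis by simp
  qed
  \<comment> \<open>Removal never lengthens the list, so the second half of the cleanup can also be
    estimated with the original length \<open>?n\<close>.\<close>
  have 2: "length A' \<le> ?n" if "A' \<in> results (if n = k + 2
      then min_c t_del (t_del (hd A)) A \<bind> (\<lambda>t.
           filter_c (\<lambda>a. step (t_del a = t)) A \<bind> (\<lambda>M.
           select M \<bind> (\<lambda>a.
           remove_c a A)))
      else step A)" for A' n
    using that by (auto simp: results_remove_c length_remove1 split: if_splits)
  have 3: "cost_le (if n' = k + 1
      then min_c t_del (t_del (hd A')) A' \<bind> (\<lambda>t_min.
           filter_c (\<lambda>q. step (\<not> t_del q < t_min)) R)
      else step R) (?n + 2 * length R + 2)" if "length A' \<le> ?n" for n' A'
  proof -
    have "cost_le (min_c t_del (t_del (hd A')) A' \<bind> (\<lambda>t_min.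
           filter_c (\<lambda>q. step (\<not> t_del q < t_min)) R)) (?n + 2 * length R + 2)"
      by (rule cost_le_bind[OF cost_le_min_c cost_le_filter_c[where n = 1]]) (use that in auto)
    then show ?thesis by simp
  qed
  show ?thesis
    unfolding cleanup_def
    apply (rule cost_le_bind[OF cost_le_length_c, where b = "7 * ?n + 2 * length R + 8"])
     apply (rule cost_le_bind[OF 1, where b = "2 * ?n + 2 * length R + 4"])
      apply (drule 2)
      apply (rule cost_le_bind[OF cost_le_mono[OF cost_le_length_c, where b = "?n + 1"],
          where b = "?n + 2 * length R + 3"])
        apply simp
       apply (rule cost_le_bind[OF 3, where b = 1])
         apply auto
    done
qed

text \<open>Everything after the two calls of \<open>takeWhile_c\<close> works on the unexpired
  prefixes. The steps add up to \<open>15 * ?n + 6 * ?m + 30\<close> for their lengths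
  \<open>?n\<close> and \<open>?m\<close>, rounded up to a common factor 40.\<close>

lemma cost_le_update_guess:
  defines "A s p \<equiv> takeWhile (\<lambda>x. t_arr p < t_del x) (attractors s)"
    and "R s p \<equiv> takeWhile (\<lambda>x. t_arr p < t_del x) (representatives s)"
  shows "cost_le (update_guess p \<gamma> s) (40 * (length (A s p) + length (R s p) + 1))"
proof -
  let ?A = "A s p" and ?R = "R s p"
  have tw: "results (takeWhile_c (\<lambda>x. step (t_arr p < t_del x)) (attractors s)) = {?A}"
    "results (takeWhile_c (\<lambda>x. step (t_arr p < t_del x)) (representatives s)) = {?R}"
    unfolding A_def R_def by (rule results_takeWhile_c; simp)+
  \<comment> \<open>\<open>?f1\<close> opens a new attractor, \<open>?f2\<close> replaces a
    representative, and \<open>?f3\<close> is the whole branch in which \<open>E\<close> is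
    nonempty.\<close>
  let ?f1 = "insert_c t_del p ?A \<bind> (\<lambda>A'.
          step ((rep s)(p := p)) \<bind> (\<lambda>rep'.
          insert_c t_del p ?R \<bind> (\<lambda>R'.
          cleanup A' R' \<bind> (\<lambda>(A'', R'').
          step \<lparr>attractors = A'', rep = rep', representatives = R''\<rparr>))))"
  let ?n = "length ?A" and ?m = "length ?R"
  have 1: "cost_le ?f1 (10 * ?n + 4 * ?m + 24)"
    apply (rule cost_le_bind[OF cost_le_insert_c, where b = "8 * ?n + 4 * ?m + 23"])
     apply (rule cost_le_step_bind[where b = "8 * ?n + 4 * ?m + 22"])
      apply (rule cost_le_bind[OF cost_le_insert_c, where b = "8 * ?n + 2 * ?m + 21"])
       apply (rule cost_le_bind[OF cost_le_cleanup, where b = 1])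
        apply (auto simp: results_insert_c)
    done
  let ?f2 = "\<lambda>a. step (rep s a) \<bind> (\<lambda>r.
               remove_c r ?R \<bind> (\<lambda>R'.
               step ((rep s)(a := p)) \<bind> (\<lambda>rep'.
               insert_c t_del p R' \<bind> (\<lambda>R''.
               step \<lparr>attractors = ?A, rep = rep', representatives = R''\<rparr>))))"
  have 2: "cost_le (?f2 a) (4 * ?m + 5)" for a
  proof -
    have *: "cost_le (step ((rep s)(a := p)) \<bind> (\<lambda>rep'. insert_c t_del p R' \<bind> (\<lambda>R''.
               step \<lparr>attractors = ?A, rep = rep', representatives = R''\<rparr>))) (2 * ?m + 3)"
      if "length R' \<le> ?m" for R'
      apply (rule cost_le_step_bind[where b = "2 * ?m + 2"])
       apply (rule cost_le_bind[OF cost_le_insert_c, where b = 1])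
      using that by auto
    show ?thesis
      apply (rule cost_le_step_bind[where b = "4 * ?m + 4"])
       apply (rule cost_le_bind[OF cost_le_remove_c, where b = "2 * ?m + 3"])
        apply (rule *)
      by (auto simp: results_remove_c length_remove1)
  qed
  let ?f3 = "\<lambda>E. filter_c (\<lambda>a. step (rep s a) \<bind> (\<lambda>r. step (t_del r < t_del p))) E \<bind> (\<lambda>E'.
          step (E' = []) \<bind> (\<lambda>E'_empty.
          if E'_empty
          then step \<lparr>attractors = ?A, rep = rep s, representatives = ?R\<rparr>
          else select E' \<bind> ?f2))"
  have 3: "cost_le (?f3 E) (3 * ?n + 4 * ?m + 8)" if "length E \<le> ?n" for E
  proof -
    have *: "cost_le (select E' \<bind> ?f2) (4 * ?m + 6)" for E'
      by (rule cost_le_bind[OF cost_le_select 2]) simp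
    show ?thesis
      apply (rule cost_le_bind[OF cost_le_filter_c[where n = 2], where b = "4 * ?m + 7"])
        apply (rule cost_le_step_bind[where b = 1]; simp)
       apply (rule cost_le_step_bind[where b = "4 * ?m + 6"])
      using that * by auto
  qed
  let ?P = "\<lambda>a. step (d a p) \<bind> (\<lambda>r. step (r \<le> 2 * \<gamma>))"
  have 4: "cost_le (filter_c ?P ?A \<bind> (\<lambda>E. step (E = []) \<bind> (\<lambda>e. if e then ?f1 else ?f3 E)))
      (13 * ?n + 4 * ?m + 26)"
    apply (rule cost_le_bind[OF cost_le_filter_c[where n = 2], where b = "10 * ?n + 4 * ?m + 25"])
      apply (rule cost_le_step_bind[where b = 1]; simp)
     apply (rule cost_le_step_bind[where b = "10 * ?n + 4 * ?m + 24"])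
    \<comment> \<open>Opening an attractor is the dearer branch:
      \<open>10 * ?n + 4 * ?m + 24\<close> against \<open>3 * ?n + 4 * ?m + 8\<close>, where
      \<open>E\<close> is no longer than the list it was filtered from.\<close>
    subgoal for E
      using 1 cost_le_mono[OF 3[of E], of "10 * ?n + 4 * ?m + 24"]
      by (auto simp: results_filter_c[where Q = "\<lambda>a. d a p \<le> 2 * \<gamma>"])
    by auto
  show ?thesis
    unfolding update_guess_def
    apply (rule cost_le_bind[OF cost_le_takeWhile_c, folded A_def,
        where b = "13 * ?n + 6 * ?m + 28"])
     apply (simp only: tw singleton_iff)
     apply (rule cost_le_bind[OF cost_le_takeWhile_c, folded R_def,
        where b = "13 * ?n + 4 * ?m + 26"])
      apply (simp only: tw singleton_iff)
      apply (rule 4)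
    by (auto simp: A_def R_def)
qed

text \<open>The added 2 pays for reading and writing back the state of a guess. Distinctness
  guarantees that this write leaves the states of the guesses still to come untouched.\<close>

lemma cost_le_update_guesses:
  assumes "distinct \<gamma>s" "\<And>\<gamma>. \<gamma> \<in> set \<gamma>s \<Longrightarrow> cost_le (update_guess p \<gamma> (\<sigma> \<gamma>)) n"
  shows "cost_le (update_guesses p \<gamma>s \<sigma>) ((n + 2) * length \<gamma>s + 1)"
  using assms
proof (induction \<gamma>s arbitrary: \<sigma>)
  case (Cons g \<gamma>s)
  have "cost_le (update_guesses p \<gamma>s (\<sigma>(g := s'))) ((n + 2) * length \<gamma>s + 1)" for s'
    by (rule Cons.IH) (use Cons.prems in auto)
  then have *: "cost_le (step (\<sigma>(g := s')) \<bind> (\<lambda>\<sigma>'. update_guesses p \<gamma>s \<sigma>'))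
      ((n + 2) * length \<gamma>s + 2)" for s'
    by (intro cost_le_step_bind[where b = "(n + 2) * length \<gamma>s + 1"]) auto
  have "cost_le (update_guess p g (\<sigma> g) \<bind> (\<lambda>s'. step (\<sigma>(g := s')) \<bind>
      (\<lambda>\<sigma>'. update_guesses p \<gamma>s \<sigma>'))) (n + ((n + 2) * length \<gamma>s + 2))"
    by (rule cost_le_bind[OF Cons.prems(2) *]) auto
  then show ?case
    unfolding update_guesses.simps
    by (rule cost_le_step_bind[where x = "\<sigma> g"]) simp
qed simp


section \<open>The number of stored points\<close>

text \<open>
  \<open>\<alpha> q\<close> is the attractor that \<open>q\<close> was chosen to represent, even if that attractor is gone.
  The attractors in \<open>spanning \<alpha> A R \<tau>\<close> were all stored together at time \<open>\<tau>\<close>.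
\<close>

definition spanning :: "('a \<Rightarrow> 'a) \<Rightarrow> 'a set \<Rightarrow> 'a set \<Rightarrow> nat \<Rightarrow> 'a set" where
  "spanning \<alpha> A R \<tau> =
     \<alpha> ` {q \<in> R. t_arr (\<alpha> q) \<le> \<tau> \<and> \<tau> \<le> t_arr q} \<union> {a \<in> A. t_arr a \<le> \<tau>}"

text \<open>An invariant with \<alpha> as ghost data. Injectivity turns counts of attractors into
  counts of representatives. Agreement with \<rho> makes \<open>\<rho> a\<close> the only possible
  representative of a stored \<open>a\<close>. The number \<open>k + 2\<close> is the most
  attractors ever stored at once, just before a cleanup. The last clause concerns removed attractors
  and only older \<open>q\<close>, since points arriving after the removal need not outlive
  them.\<close>

definition attributed :: "'a set \<Rightarrow> ('a \<Rightarrow> 'a) \<Rightarrow> 'a set \<Rightarrow> ('a \<Rightarrow> 'a) \<Rightarrow> 'a set \<Rightarrow> bool" where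
  "attributed Q \<alpha> A \<rho> R \<longleftrightarrow>
     A \<subseteq> Q \<and> R \<subseteq> Q \<and> inj_on \<alpha> R \<and> \<alpha> ` R \<subseteq> Q \<and>
     (\<forall>q\<in>R. \<alpha> q \<in> A \<longrightarrow> \<rho> (\<alpha> q) = q) \<and>
     (\<forall>\<tau>. card (spanning \<alpha> A R \<tau>) \<le> k + 2) \<and>
     (\<forall>r\<in>R. \<forall>q\<in>R. \<alpha> r \<notin> A \<longrightarrow> t_arr q < t_arr (\<alpha> r) \<longrightarrow> t_del (\<alpha> r) \<le> t_del q)"

section \<open>Preservation of the invariant by the set-level operations\<close>

lemma attributedI:
  assumes "A \<subseteq> Q" "R \<subseteq> Q" "inj_on \<alpha> R" "\<alpha> ` R \<subseteq> Q"
    and "\<And>q. q \<in> R \<Longrightarrow> \<alpha> q \<in> A \<Longrightarrow> \<rho> (\<alpha> q) = q"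
    and "\<And>\<tau>. card (spanning \<alpha> A R \<tau>) \<le> k + 2"
    and "\<And>r q. r \<in> R \<Longrightarrow> q \<in> R \<Longrightarrow> \<alpha> r \<notin> A \<Longrightarrow> t_arr q < t_arr (\<alpha> r) \<Longrightarrow> t_del (\<alpha> r) \<le> t_del q"
  shows "attributed Q \<alpha> A \<rho> R"
  using assms by (simp add: attributed_def)

lemma finite_spanning: "finite Q \<Longrightarrow> attributed Q \<alpha> A \<rho> R \<Longrightarrow> finite (spanning \<alpha> A R \<tau>)"
  unfolding attributed_def spanning_def by (auto intro: finite_subset)

text \<open>Serves both expiry and cleanup. The last clause of \<open>attributed\<close> gains new
  instances only from attractors dropped just now, and for these the final assumption supplies
  it.\<close>

lemma attributed_shrink:
  assumes "attributed Q \<alpha> A \<rho> R" "finite Q" "A' \<subseteq> A" "R' \<subseteq> R"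
    and "\<And>a q. a \<in> A - A' \<Longrightarrow> q \<in> R' \<Longrightarrow> t_del a \<le> t_del q"
  shows "attributed Q \<alpha> A' \<rho> R'"
proof -
  have old: "A \<subseteq> Q" "R \<subseteq> Q" "inj_on \<alpha> R" "\<alpha> ` R \<subseteq> Q"
    "\<And>q. q \<in> R \<Longrightarrow> \<alpha> q \<in> A \<Longrightarrow> \<rho> (\<alpha> q) = q"
    "card (spanning \<alpha> A R \<tau>) \<le> k + 2"
    "\<And>r q. r \<in> R \<Longrightarrow> q \<in> R \<Longrightarrow> \<alpha> r \<notin> A \<Longrightarrow> t_arr q < t_arr (\<alpha> r) \<Longrightarrow> t_del (\<alpha> r) \<le> t_del q" for \<tau>
    using assms(1) by (auto simp: attributed_def)
  show ?thesis
  proof (rule attributedI)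
    show "card (spanning \<alpha> A' R' \<tau>) \<le> k + 2" for \<tau>
    proof -
      have "spanning \<alpha> A' R' \<tau> \<subseteq> spanning \<alpha> A R \<tau>"
        using assms(3,4) by (auto simp: spanning_def)
      then have "card (spanning \<alpha> A' R' \<tau>) \<le> card (spanning \<alpha> A R \<tau>)"
        using finite_spanning assms(1,2) by (intro card_mono)
      also have "\<dots> \<le> k + 2" by (rule old)
      finally show ?thesis .
    qed
    show "t_del (\<alpha> r) \<le> t_del q"
      if "r \<in> R'" "q \<in> R'" "\<alpha> r \<notin> A'" "t_arr q < t_arr (\<alpha> r)" for r q
    proof (cases "\<alpha> r \<in> A")
      case True
      then show ?thesis using that assms(5) by blast
    next
      case False
      then show ?thesis using that old(7)[of r q] assms(4) by blast
    qed
    show "inj_on \<alpha> R'" using old(3) assms(4) by (rule inj_on_subset)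
    show "A' \<subseteq> Q" "R' \<subseteq> Q" using old(1,2) assms(3,4) by auto
    show "\<alpha> ` R' \<subseteq> Q" by (rule order_trans[OF image_mono[OF assms(4)] old(4)])
    show "\<rho> (\<alpha> q) = q" if "q \<in> R'" "\<alpha> q \<in> A'" for q
      using that old(5) assms(3,4) by auto
  qed
qed

lemma attributed_new_attractor:
  assumes "attributed Q \<alpha> A \<rho> R" "finite Q" "card A \<le> k + 1"
    and "p \<notin> Q" and arr: "\<And>q. q \<in> Q \<Longrightarrow> t_arr q < t_arr p"
  shows "attributed (insert p Q) (\<alpha>(p := p)) (insert p A) (\<rho>(p := p)) (insert p R)"
proof -
  have old: "A \<subseteq> Q" "R \<subseteq> Q" "inj_on \<alpha> R" "\<alpha> ` R \<subseteq> Q" "\<forall>q\<in>R. \<alpha> q \<in> A \<longrightarrow> \<rho> (\<alpha> q) = q"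
    "card (spanning \<alpha> A R \<tau>) \<le> k + 2"
    "\<forall>r\<in>R. \<forall>q\<in>R. \<alpha> r \<notin> A \<longrightarrow> t_arr q < t_arr (\<alpha> r) \<longrightarrow> t_del (\<alpha> r) \<le> t_del q" for \<tau>
    using assms(1) by (auto simp: attributed_def)
  have "p \<notin> R" using old assms by blast
  have \<alpha>: "(\<alpha>(p := p)) q = \<alpha> q" "\<alpha> q \<noteq> p" "\<alpha> q \<in> Q" if "q \<in> R" for q
    using that old assms by auto
  have "inj_on (\<alpha>(p := p)) (insert p R)"
  proof (rule inj_onI)
    fix q r
    assume "q \<in> insert p R" "r \<in> insert p R" "(\<alpha>(p := p)) q = (\<alpha>(p := p)) r"
    then show "q = r"
      using \<alpha>(1,2)[of q] \<alpha>(1,2)[of r] inj_onD[OF old(3), of q r] by (cases "q = p"; cases "r = p") auto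
  qed
  moreover have "card (spanning (\<alpha>(p := p)) (insert p A) (insert p R) \<tau>) \<le> k + 2" for \<tau>
  proof (cases "\<tau> < t_arr p")
    case True
    then have "spanning (\<alpha>(p := p)) (insert p A) (insert p R) \<tau> = spanning \<alpha> A R \<tau>"
      using \<open>p \<notin> R\<close> by (auto simp: spanning_def image_iff)
    then show ?thesis using old by simp
  next
    \<comment> \<open>From the arrival of \<open>p\<close> on, every older representative has
      arrived before \<tau>, so only stored attractors and \<open>p\<close> itself
      contribute.\<close>
    case False
    then have "spanning (\<alpha>(p := p)) (insert p A) (insert p R) \<tau> \<subseteq> insert p A"
      using arr old(2) by (fastforce simp: spanning_def)
    moreover have "finite A" using old(1) assms(2) by (rule finite_subset)
    ultimately have "card (spanning (\<alpha>(p := p)) (insert p A) (insert p R) \<tau>) \<le> card (insert p A)"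
      by (intro card_mono) auto
    also have "\<dots> \<le> k + 2" using assms(3) \<open>finite A\<close> by (simp add: card_insert_if)
    finally show ?thesis .
  qed
  moreover have "t_del ((\<alpha>(p := p)) r) \<le> t_del q"
    if "r \<in> insert p R" "q \<in> insert p R" "(\<alpha>(p := p)) r \<notin> insert p A"
      "t_arr q < t_arr ((\<alpha>(p := p)) r)" for r q
  proof -
    have "r \<in> R" using that by auto
    \<comment> \<open>The case \<open>q = p\<close> is impossible: \<open>\<alpha> r\<close> lies in
      \<open>Q\<close> and hence arrived before \<open>p\<close>.\<close>
    then have "q \<in> R" using that \<alpha>[of r] arr[of "\<alpha> r"] by auto
    then show ?thesis using \<open>r \<in> R\<close> that old \<alpha> by auto
  qed
  moreover have "(\<rho>(p := p)) ((\<alpha>(p := p)) q) = q"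
    if "q \<in> insert p R" "(\<alpha>(p := p)) q \<in> insert p A" for q
    using that old(5) \<alpha>(1,2)[of q] by (cases "q = p") auto
  moreover have "insert p A \<subseteq> insert p Q" "insert p R \<subseteq> insert p Q"
    "(\<alpha>(p := p)) ` insert p R \<subseteq> insert p Q"
    using old \<alpha> by auto
  ultimately show ?thesis by (intro attributedI)
qed

text \<open>Any other representative attributed to \<open>a\<close> would equal
  \<open>\<rho> a\<close>, which is removed; so \<alpha> stays injective. No span grows, because
  \<open>a\<close> is still stored and thus already counted at every \<tau> from its arrival
  on.\<close>

lemma attributed_new_representative:
  assumes "attributed Q \<alpha> A \<rho> R" "finite Q" "a \<in> A"
    and "p \<notin> Q" and arr: "\<And>q. q \<in> Q \<Longrightarrow> t_arr q < t_arr p"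
  shows "attributed (insert p Q) (\<alpha>(p := a)) A (\<rho>(a := p)) (insert p (R - {\<rho> a}))"
proof -
  let ?R = "insert p (R - {\<rho> a})" and ?\<alpha> = "\<alpha>(p := a)"
  have old: "A \<subseteq> Q" "R \<subseteq> Q" "inj_on \<alpha> R" "\<alpha> ` R \<subseteq> Q" "\<forall>q\<in>R. \<alpha> q \<in> A \<longrightarrow> \<rho> (\<alpha> q) = q"
    "card (spanning \<alpha> A R \<tau>) \<le> k + 2"
    "\<forall>r\<in>R. \<forall>q\<in>R. \<alpha> r \<notin> A \<longrightarrow> t_arr q < t_arr (\<alpha> r) \<longrightarrow> t_del (\<alpha> r) \<le> t_del q" for \<tau>
    using assms(1) by (auto simp: attributed_def)
  have "p \<notin> R" using old assms by blast
  have \<alpha>: "?\<alpha> q = \<alpha> q" "\<alpha> q \<noteq> a" "\<alpha> q \<in> Q" if "q \<in> R - {\<rho> a}" for q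
    using that old assms by auto
  have "inj_on ?\<alpha> ?R"
  proof (rule inj_onI)
    fix q r
    assume "q \<in> ?R" "r \<in> ?R" "?\<alpha> q = ?\<alpha> r"
    then show "q = r"
      using \<alpha>(1,2)[of q] \<alpha>(1,2)[of r] inj_onD[OF old(3), of q r] by (cases "q = p"; cases "r = p") auto
  qed
  moreover have "card (spanning ?\<alpha> A ?R \<tau>) \<le> k + 2" for \<tau>
  proof -
    have "spanning ?\<alpha> A ?R \<tau> \<subseteq> spanning \<alpha> A R \<tau>"
      using \<open>p \<notin> R\<close> \<open>a \<in> A\<close> by (auto simp: spanning_def image_iff)
    then have "card (spanning ?\<alpha> A ?R \<tau>) \<le> card (spanning \<alpha> A R \<tau>)"
      using finite_spanning assms(1,2) by (intro card_mono)
    then show ?thesis using old(6)[of \<tau>] by simp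
  qed
  moreover have "t_del (?\<alpha> r) \<le> t_del q"
    if "r \<in> ?R" "q \<in> ?R" "?\<alpha> r \<notin> A" "t_arr q < t_arr (?\<alpha> r)" for r q
  proof -
    have r: "r \<in> R - {\<rho> a}" using that \<open>a \<in> A\<close> by auto
    then have "q \<in> R" using that \<alpha>[of r] arr[of "\<alpha> r"] by auto
    then show ?thesis using r that old \<alpha>(1)[OF r] by auto
  qed
  moreover have "(\<rho>(a := p)) (?\<alpha> q) = q" if "q \<in> ?R" "?\<alpha> q \<in> A" for q
    using that old(5) \<alpha>(1,2)[of q] by (cases "q = p") auto
  moreover have "A \<subseteq> insert p Q" "?R \<subseteq> insert p Q" "?\<alpha> ` ?R \<subseteq> insert p Q"
    using old \<alpha> assms(3) by auto
  ultimately show ?thesis by (intro attributedI)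
qed

lemma attributed_mono: "attributed Q \<alpha> A \<rho> R \<Longrightarrow> Q \<subseteq> Q' \<Longrightarrow> attributed Q' \<alpha> A \<rho> R"
  unfolding attributed_def by blast

lemma attributed_cleanup:
  assumes "attributed Q \<alpha> A \<rho> R" "finite Q" "card A \<le> k + 2" "(A', R') \<in> Cleanup A R"
  shows "attributed Q \<alpha> A' \<rho> R' \<and> card A' \<le> k + 1"
proof (cases "card A = k + 2")
  case True
  then obtain a where a: "a \<in> A" "\<forall>b\<in>A. t_del a \<le> t_del b" "A' = A - {a}"
    and R': "R' = (if card A' = k + 1 then R - {q. t_del q < Min (t_del ` A')} else R)"
    using assms(4) by (auto simp: Cleanup_def)
  have "finite A" using assms(1,2) by (auto simp: attributed_def intro: finite_subset)
  \<comment> \<open>Removing one of \<open>k + 2\<close> attractors leaves exactly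
    \<open>k + 1\<close>, so the pruning of \<open>R\<close> takes place. What it keeps is deleted
    no earlier than any attractor of \<open>A'\<close>, hence no earlier than
    \<open>a\<close>.\<close>
  then have c: "card A' = k + 1" using a True by simp
  then have "A' \<noteq> {}" by auto
  moreover have "finite A'" using \<open>finite A\<close> a by simp
  ultimately have "t_del a \<le> Min (t_del ` A')" using a by auto
  then have "t_del a \<le> t_del q" if "q \<in> R'" for q
    using that R' c by auto
  then have "attributed Q \<alpha> A' \<rho> R'"
    using a R' by (intro attributed_shrink[OF assms(1,2)]) (auto split: if_splits)
  then show ?thesis using c by simp
next
  case False
  then have "A' = A" "R' \<subseteq> R"
    using assms(4) by (auto simp: Cleanup_def split: if_splits)
  then show ?thesis
    using attributed_shrink[OF assms(1,2), of A R'] False assms(3) by auto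
qed

lemma attributed_update:
  assumes "attributed Q \<alpha> A \<rho> R" "finite Q" "card A \<le> k + 1"
    and "p \<notin> Q" and "\<And>q. q \<in> Q \<Longrightarrow> t_arr q < t_arr p"
    and "(A', \<rho>', R') \<in> Update p \<gamma> (A, \<rho>, R)"
  shows "\<exists>\<alpha>'. attributed (insert p Q) \<alpha>' A' \<rho>' R' \<and> card A' \<le> k + 1"
proof -
  define B where "B = A - {x. t_del x \<le> t_arr p}"
  define S where "S = R - {x. t_del x \<le> t_arr p}"
  define E where "E = {a \<in> B. d a p \<le> 2 * \<gamma>}"
  define E' where "E' = {a \<in> E. t_del (\<rho> a) < t_del p}"
  have finA: "finite A" using assms(1,2) by (auto simp: attributed_def intro: finite_subset)
  \<comment> \<open>Expired attractors are deleted by the arrival of \<open>p\<close>, surviving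
    representatives only after it.\<close>
  have att: "attributed Q \<alpha> B \<rho> S"
    by (rule attributed_shrink[OF assms(1,2)]) (auto simp: B_def S_def)
  have cB: "card B \<le> k + 1"
    using card_mono[OF finA, of B] assms(3) by (auto simp: B_def)
  have "(A', \<rho>', R') \<in> (if E = {} then {(A', \<rho>(p := p), R') | A' R'.
        (A', R') \<in> Cleanup (insert p B) (insert p S)}
     else if E' = {} then {(B, \<rho>, S)}
     else {(B, \<rho>(a := p), insert p (S - {\<rho> a})) | a. a \<in> E'})"
    using assms(6) unfolding Update_def Let_def prod.case
    unfolding B_def[symmetric] S_def[symmetric] unfolding E_def[symmetric]
    unfolding E'_def[symmetric] .
  then consider "\<rho>' = \<rho>(p := p)" "(A', R') \<in> Cleanup (insert p B) (insert p S)"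
    | "A' = B" "\<rho>' = \<rho>" "R' = S"
    | a where "a \<in> E'" "A' = B" "\<rho>' = \<rho>(a := p)" "R' = insert p (S - {\<rho> a})"
    by (auto split: if_splits)
  then show ?thesis
  proof cases
    case 1
    have "finite B" using finA by (simp add: B_def)
    then have "card (insert p B) \<le> k + 2" using cB by (simp add: card_insert_if)
    then show ?thesis
      using attributed_cleanup[OF attributed_new_attractor[OF att assms(2) cB assms(4,5)] _ _ 1(2)]
        1(1) assms(2) by auto
  next
    case 2
    then show ?thesis using att cB attributed_mono by blast
  next
    case (3 a)
    then have "a \<in> B" by (auto simp: E'_def E_def)
    then show ?thesis
      using attributed_new_representative[OF att assms(2) _ assms(4,5)] 3 cB by blast
  qed
qed

section \<open>The invariant along runs and the count of representatives it yields\<close>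

lemma update_guesses_notin:
  assumes "(\<sigma>', c) \<in> update_guesses p \<gamma>s \<sigma>" "\<gamma> \<notin> set \<gamma>s"
  shows "\<sigma>' \<gamma> = \<sigma> \<gamma>"
  using assms
proof (induction \<gamma>s arbitrary: \<sigma> c)
  case (Cons g \<gamma>s)
  then obtain s' c' where "(\<sigma>', c') \<in> update_guesses p \<gamma>s (\<sigma>(g := s'))"
    by (auto simp: bind_def step_def)
  then have "\<sigma>' \<gamma> = (\<sigma>(g := s')) \<gamma>" using Cons.IH Cons.prems(2) by simp
  then show ?case using Cons.prems(2) by simp
qed (simp add: step_def)

text \<open>In a distinct list a guess is processed at most once, and then from its original state.
  The first alternative covers reals outside the list, so that the invariant can be proved for
  arbitrary \<gamma>.\<close>

lemma update_guesses_result: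
  assumes "(\<sigma>', c) \<in> update_guesses p \<gamma>s \<sigma>" "distinct \<gamma>s"
  shows "\<sigma>' \<gamma> = \<sigma> \<gamma> \<or> \<sigma>' \<gamma> \<in> results (update_guess p \<gamma> (\<sigma> \<gamma>))"
  using assms
proof (induction \<gamma>s arbitrary: \<sigma> c)
  case Nil
  then show ?case by (simp add: step_def)
next
  case (Cons g \<gamma>s)
  then obtain s' c' c'' where s': "(s', c') \<in> update_guess p g (\<sigma> g)"
    and \<sigma>': "(\<sigma>', c'') \<in> update_guesses p \<gamma>s (\<sigma>(g := s'))"
    by (auto simp: bind_def step_def)
  have rest: "\<sigma>' g = s'"
    using update_guesses_notin[OF \<sigma>'] Cons.prems(2) by simp
  show ?case
  proof (cases "\<gamma> = g")
    case True
    then show ?thesis using rest s' by (force simp: results_def)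
  next
    case False
    then show ?thesis using Cons.IH[OF \<sigma>'] Cons.prems by auto
  qed
qed

lemma run_chronological:
  "run Q \<sigma> \<Longrightarrow> Q \<subseteq> X \<and> (\<forall>q\<in>Q. \<forall>x\<in>X - Q. t_arr q < t_arr x)"
proof (induction rule: run.induct)
  case (run_update Q \<sigma> p \<sigma>' c)
  \<comment> \<open>The next point is chosen with a weak inequality; injectivity of arrival times
    makes it strict.\<close>
  then have "t_arr p < t_arr x" if "x \<in> X - insert p Q" for x
    using that inj_arr by (metis DiffD1 DiffD2 DiffI insertCI inj_on_eq_iff order_neq_le_trans)
  with run_update show ?case by auto
qed simp

text \<open>The state does not record \<alpha>, so it is quantified existentially and rebuilt at
  each update. Between updates at most \<open>k + 1\<close> attractors remain; \<open>k + 2\<close>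
  occurs only transiently.\<close>

lemma run_attributed:
  "run Q \<sigma> \<Longrightarrow> \<exists>\<alpha>. attributed Q \<alpha> (set (attractors (\<sigma> \<gamma>))) (rep (\<sigma> \<gamma>))
      (set (representatives (\<sigma> \<gamma>))) \<and> card (set (attractors (\<sigma> \<gamma>))) \<le> k + 1"
proof (induction rule: run.induct)
  case run_init
  then show ?case by (auto simp: initial_def attributed_def spanning_def)
next
  case (run_update Q \<sigma> p \<sigma>' c)
  let ?A = "\<lambda>\<sigma>. set (attractors (\<sigma> \<gamma>))" and ?\<rho> = "\<lambda>\<sigma>. rep (\<sigma> \<gamma>)"
    and ?R = "\<lambda>\<sigma>. set (representatives (\<sigma> \<gamma>))"
  obtain \<alpha> where \<alpha>: "attributed Q \<alpha> (?A \<sigma>) (?\<rho> \<sigma>) (?R \<sigma>)" "card (?A \<sigma>) \<le> k + 1"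
    using run_update by blast
  have Q: "Q \<subseteq> X" "\<And>q. q \<in> Q \<Longrightarrow> t_arr q < t_arr p" "p \<notin> Q"
    using run_chronological[OF run_update.hyps(1)] run_update.hyps(2) by auto
  have "finite Q" using Q(1) X_finite finite_subset by blast
  have "\<sigma>' \<gamma> = \<sigma> \<gamma> \<or> \<sigma>' \<gamma> \<in> results (update_guess p \<gamma> (\<sigma> \<gamma>))"
    using update_guesses_result run_update.hyps(4) unfolding update_def by simp
  then show ?case
  proof
    assume "\<sigma>' \<gamma> = \<sigma> \<gamma>"
    then show ?thesis using \<alpha> attributed_mono[of Q \<alpha>] by (metis subset_insertI)
  next
    assume "\<sigma>' \<gamma> \<in> results (update_guess p \<gamma> (\<sigma> \<gamma>))"
    then have "set_state (\<sigma>' \<gamma>) \<in> Update p \<gamma> (set_state (\<sigma> \<gamma>))"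
      using run_update_guess_set[OF run_update.hyps(1) Q(3)] by blast
    then show ?thesis
      unfolding set_state_def
      by (intro attributed_update[OF \<alpha>(1) \<open>finite Q\<close> \<alpha>(2) Q(3,2)])
  qed
qed

text \<open>The earliest \<open>q\<close> in \<open>S\<close> is not deleted before
  \<open>x\<close>, so H-orderedness forces fewer than \<open>H\<close> arrivals strictly between
  them. The rest of \<open>S\<close> lies in that gap, and \<open>q\<close> adds one.\<close>

lemma card_inversions:
  assumes "H_ordered H" "x \<in> X" "S \<subseteq> X" "\<And>q. q \<in> S \<Longrightarrow> t_arr q < t_arr x \<and> t_del x \<le> t_del q"
  shows "card S \<le> H"
proof (cases "S = {}")
  case False
  have "finite S" using assms X_finite finite_subset by blast
  then obtain q where q: "q \<in> S" "\<And>r. r \<in> S \<Longrightarrow> t_arr q \<le> t_arr r"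
    using False by (metis arg_min_if_finite(1) arg_min_least)
  let ?I = "{r \<in> X. t_arr q < t_arr r \<and> t_arr r < t_arr x}"
  have "card ?I < H"
    using assms(1,2) assms(4)[OF q(1)] q(1) assms(3) not_le unfolding H_ordered_def by blast
  moreover have "S - {q} \<subseteq> ?I"
  proof
    fix r
    assume r: "r \<in> S - {q}"
    then have "t_arr q \<noteq> t_arr r"
      using inj_onD[OF inj_arr, of q r] q(1) assms(3) by auto
    then show "r \<in> ?I" using r q(2)[of r] assms(3,4) by auto
  qed
  then have "card (S - {q}) \<le> card ?I"
    using X_finite by (intro card_mono) auto
  ultimately show ?thesis using \<open>finite S\<close> q(1) by simp
qed simp

text \<open>The summands are \<open>H\<close> for representatives older than a suitable removed
  attractor, \<open>k + 1\<close> for those whose attractor is stored, and \<open>k + 2\<close> for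
  the remaining ones.\<close>

lemma card_representatives:
  assumes "H_ordered H" "attributed Q \<alpha> A \<rho> R" "card A \<le> k + 1" "Q \<subseteq> X"
  shows "card R \<le> H + 2 * k + 3"
proof -
  have old: "A \<subseteq> Q" "R \<subseteq> Q" "inj_on \<alpha> R" "\<alpha> ` R \<subseteq> Q"
    "card (spanning \<alpha> A R \<tau>) \<le> k + 2"
    "\<forall>r\<in>R. \<forall>q\<in>R. \<alpha> r \<notin> A \<longrightarrow> t_arr q < t_arr (\<alpha> r) \<longrightarrow> t_del (\<alpha> r) \<le> t_del q" for \<tau>
    using assms(2) by (auto simp: attributed_def)
  have fin: "finite Q" "finite A" "finite R"
    using assms(4) old(1,2) X_finite finite_subset by metis+
  have kept: "card {q \<in> R. \<alpha> q \<in> A} \<le> k + 1"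
  proof -
    have "card {q \<in> R. \<alpha> q \<in> A} \<le> card A"
      using old(3) fin by (intro card_inj_on_le[of \<alpha>]) (auto simp: inj_on_def)
    then show ?thesis using assms(3) by simp
  qed
  show ?thesis
  proof (cases "\<alpha> ` R \<subseteq> A")
    case True
    then have "{q \<in> R. \<alpha> q \<in> A} = R" by auto
    then show ?thesis using kept by simp
  next
    case False
    define O' where "O' = {q \<in> R. \<alpha> q \<notin> A}"
    have "finite (\<alpha> ` O')" "\<alpha> ` O' \<noteq> {}" using False fin by (auto simp: O'_def)
    \<comment> \<open>\<open>L\<close> is the last arrived removed attractor with a surviving
      representative. By its maximality, every \<open>q\<close> in \<open>O'\<close> arriving no
      earlier than \<open>L\<close> has its attractor in the span at \<open>t_arr L\<close>.\<close>
    then obtain L where "L \<in> \<alpha> ` O'" and L: "\<And>b. b \<in> \<alpha> ` O' \<Longrightarrow> t_arr b \<le> t_arr L"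
      using Max_in[of "t_arr ` \<alpha> ` O'"] Max_ge[of "t_arr ` \<alpha> ` O'"] by fastforce
    then obtain r where r: "r \<in> R" "\<alpha> r \<notin> A" "L = \<alpha> r" by (auto simp: O'_def)
    \<comment> \<open>As \<open>L\<close> is no longer stored, the last clause of the invariant
      makes each of these points an inversion with \<open>L\<close>.\<close>
    have "card {q \<in> R. t_arr q < t_arr L} \<le> H"
      by (rule card_inversions[OF assms(1), of L]) (use r old assms(4) in auto)
    moreover have "card {q \<in> O'. t_arr L \<le> t_arr q} \<le> k + 2"
    proof -
      have "card {q \<in> O'. t_arr L \<le> t_arr q} \<le> card (spanning \<alpha> A R (t_arr L))"
      proof (rule card_inj_on_le[of \<alpha>])
        show "inj_on \<alpha> {q \<in> O'. t_arr L \<le> t_arr q}"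
          using old(3) by (auto simp: inj_on_def O'_def)
        show "\<alpha> ` {q \<in> O'. t_arr L \<le> t_arr q} \<subseteq> spanning \<alpha> A R (t_arr L)"
          using L by (auto simp: spanning_def O'_def)
        show "finite (spanning \<alpha> A R (t_arr L))" using finite_spanning fin assms by blast
      qed
      then show ?thesis using old(5)[of "t_arr L"] by simp
    qed
    moreover have "card R \<le> card ({q \<in> R. t_arr q < t_arr L} \<union>
        ({q \<in> R. \<alpha> q \<in> A} \<union> {q \<in> O'. t_arr L \<le> t_arr q}))"
      using fin by (intro card_mono) (auto simp: O'_def)
    moreover have "\<dots> \<le> card {q \<in> R. t_arr q < t_arr L} +
        (card {q \<in> R. \<alpha> q \<in> A} + card {q \<in> O'. t_arr L \<le> t_arr q})"
      by (meson card_Un_le add_left_mono order_trans)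
    ultimately show ?thesis using kept by linarith
  qed
qed

text \<open>The factor 320 is 40 operations per unit times 8, where 8 absorbs the additive constants
  in both bounds on the unexpired prefixes.\<close>

lemma cost_le_run_update_guess:
  assumes "H_ordered H" "p \<in> X" "run {q \<in> X. t_arr q < t_arr p} \<sigma>"
  shows "cost_le (update_guess p \<gamma> (\<sigma> \<gamma>)) (320 * min (k + H) (card (active (t_arr p))))"
proof -
  let ?Q = "{q \<in> X. t_arr q < t_arr p}" and ?s = "\<sigma> \<gamma>"
  let ?tw = "takeWhile (\<lambda>x. t_arr p < t_del x)"
  obtain \<alpha> where \<alpha>: "attributed ?Q \<alpha> (set (attractors ?s)) (rep ?s) (set (representatives ?s))"
    "card (set (attractors ?s)) \<le> k + 1"
    using run_attributed[OF assms(3)] by blast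
  have R: "card (set (representatives ?s)) \<le> H + 2 * k + 3"
    by (rule card_representatives[OF assms(1) \<alpha>]) auto
  have ord: "ordered_list ?Q (attractors ?s)" "ordered_list ?Q (representatives ?s)"
    using run_ordered[OF assms(3)] by (auto simp: ordered_state_def)
  have fin: "finite (active (t_arr p))" using X_finite by (simp add: active_def)
  have p: "p \<in> active (t_arr p)" using assms(2) arr_less_del by (simp add: active_def)
  have len: "length (?tw xs) \<le> card (set xs)" "length (?tw xs) \<le> card (active (t_arr p)) - 1"
    if "ordered_list ?Q xs" for xs
  proof -
    have xs: "distinct xs" "set xs \<subseteq> ?Q" using that by (auto simp: ordered_list_def)
    then show "length (?tw xs) \<le> card (set xs)"
      using length_takeWhile_le by (metis distinct_card)
    \<comment> \<open>The stored points all arrived before \<open>p\<close>, so \<open>p\<close> is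
      active but not among them.\<close>
    have "set (?tw xs) \<subseteq> active (t_arr p) - {p}"
      using xs(2) by (auto simp: active_def dest: set_takeWhileD)
    then have "card (set (?tw xs)) \<le> card (active (t_arr p) - {p})"
      using fin by (intro card_mono) auto
    then show "length (?tw xs) \<le> card (active (t_arr p)) - 1"
      using xs(1) fin p by (simp add: distinct_card distinct_takeWhile)
  qed
  have "0 < card (active (t_arr p))" using fin p card_gt_0_iff by blast
  then have "length (?tw (attractors ?s)) + length (?tw (representatives ?s)) + 1
      \<le> 8 * card (active (t_arr p))"
    using len(2)[OF ord(1)] len(2)[OF ord(2)] by linarith
  \<comment> \<open>The counts \<open>k + 1\<close> and \<open>H + 2 * k + 3\<close> give
    \<open>H + 3 * k + 5\<close> in total, which is at most \<open>8 * (k + H)\<close> because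
    \<open>k\<close> is at least 1.\<close>
  moreover have "length (?tw (attractors ?s)) + length (?tw (representatives ?s)) + 1
      \<le> 8 * (k + H)"
    using le_trans[OF len(1)[OF ord(1)] \<alpha>(2)] le_trans[OF len(1)[OF ord(2)] R] k_pos by simp
  ultimately have "length (?tw (attractors ?s)) + length (?tw (representatives ?s)) + 1
      \<le> 8 * min (k + H) (card (active (t_arr p)))"
    by (simp only: min_def split: if_splits) simp
  then show ?thesis
    by (intro cost_le_mono[OF cost_le_update_guess]) simp
qed


section \<open>The number of radius guesses\<close>

lemma distances_facts: "finite distances" "distances \<noteq> {}" "\<And>r. r \<in> distances \<Longrightarrow> 0 < r"
proof -
  have "distances \<subseteq> (\<lambda>(p, q). d p q) ` (X \<times> X)" by (auto simp: distances_def)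
  then show "finite distances" using X_finite finite_subset by blast
  obtain p q where "p \<in> X" "q \<in> X" "p \<noteq> q"
    using two_points by (metis card_le_Suc0_iff_eq X_finite not_less_eq_eq numeral_2_eq_2)
  then show "distances \<noteq> {}" by (auto simp: distances_def)
  show "0 < r" if "r \<in> distances" for r
    using that X_subset mdist_pos_less unfolding distances_def by blast
qed

lemma card_guesses: "real (card \<Gamma>) \<le> ln aspect_ratio / ln (1 + \<beta>) + 3"
proof -
  have dmin: "0 < d_min" using distances_facts Min_in by (simp add: d_min_def)
  have "d_min \<le> d_max" unfolding d_min_def d_max_def
    using distances_facts by (meson Max_ge Min_in)
  have b: "1 < 1 + \<beta>" using eps_pos by (simp add: \<beta>_def)
  let ?l = "\<lfloor>log (1 + \<beta>) d_min\<rfloor>" and ?u = "\<lceil>log (1 + \<beta>) d_max\<rceil>"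
  have G: "\<Gamma> = (\<lambda>i. (1 + \<beta>) powi i) ` {?l..?u}" by (auto simp: \<Gamma>_def)
  have "log (1 + \<beta>) d_min \<le> log (1 + \<beta>) d_max"
    using dmin \<open>d_min \<le> d_max\<close> b by simp
  then have "?l \<le> ?u" by linarith
  have "card \<Gamma> \<le> nat (?u - ?l + 1)"
    using card_image_le[of "{?l..?u}" "\<lambda>i. (1 + \<beta>) powi i"] G by simp
  then have "real (card \<Gamma>) \<le> of_int ?u - of_int ?l + 1"
    using \<open>?l \<le> ?u\<close> by linarith
  \<comment> \<open>Rounding down and rounding up lose at most one each, in addition to the 1 from
    counting both endpoints.\<close>
  also have "\<dots> \<le> log (1 + \<beta>) d_max - log (1 + \<beta>) d_min + 3" by linarith
  also have "log (1 + \<beta>) d_max - log (1 + \<beta>) d_min = ln aspect_ratio / ln (1 + \<beta>)"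
    using dmin \<open>d_min \<le> d_max\<close>
    by (simp add: log_def aspect_ratio_def ln_div diff_divide_distrib)
  finally show "real (card \<Gamma>) \<le> ln aspect_ratio / ln (1 + \<beta>) + 3" by simp
qed

text \<open>The bound on \<epsilon> makes \<open>ln (1 + \<beta>)\<close> at least a fixed multiple
  of \<epsilon>. The additive 4, namely 3 from rounding and 1 for the end of the loop, is absorbed
  because \<open>ln aspect_ratio / \<epsilon>\<close> is at least
  \<open>ln \<Delta>\<^sub>0 / \<epsilon>\<^sub>0\<close>.\<close>

lemma card_guesses_le:
  assumes "1 < \<Delta>\<^sub>0" "\<epsilon> \<le> \<epsilon>\<^sub>0" "\<Delta>\<^sub>0 \<le> aspect_ratio"
  shows "real (card \<Gamma>) + 1 \<le> (6 + \<epsilon>\<^sub>0 + 4 * \<epsilon>\<^sub>0 / ln \<Delta>\<^sub>0) * (ln aspect_ratio / \<epsilon>)"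
proof -
  let ?l = "ln aspect_ratio"
  have pos: "0 < ln \<Delta>\<^sub>0" using assms by simp
  have l: "ln \<Delta>\<^sub>0 \<le> ?l" using assms by simp
  have \<beta>: "0 < \<beta>" "\<beta> = \<epsilon> / 6" using eps_pos by (simp_all add: \<beta>_def)
  \<comment> \<open>This is the inequality \<open>ln x \<le> x - 1\<close> at the reciprocal of
    \<open>1 + \<beta>\<close>.\<close>
  have "\<beta> / (1 + \<beta>) \<le> ln (1 + \<beta>)"
    using ln_le_minus_one[of "1 / (1 + \<beta>)"] \<beta>(1) by (simp add: ln_div field_simps)
  moreover have "\<epsilon> / (6 + \<epsilon>\<^sub>0) \<le> \<beta> / (1 + \<beta>)"
    using assms eps_pos \<beta>(2) by (simp add: field_simps)
  ultimately have "\<epsilon> / (6 + \<epsilon>\<^sub>0) \<le> ln (1 + \<beta>)" by simp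
  moreover have "0 < \<epsilon> / (6 + \<epsilon>\<^sub>0)" using eps_pos assms(2) by simp
  ultimately have "?l / ln (1 + \<beta>) \<le> ?l / (\<epsilon> / (6 + \<epsilon>\<^sub>0))"
    using l pos by (intro divide_left_mono mult_pos_pos) linarith+
  moreover have "4 \<le> 4 * \<epsilon>\<^sub>0 / ln \<Delta>\<^sub>0 * (?l / \<epsilon>)"
  proof -
    have "ln \<Delta>\<^sub>0 * \<epsilon> \<le> ?l * \<epsilon>\<^sub>0" using l pos eps_pos assms by (intro mult_mono) auto
    then show ?thesis using pos eps_pos by (simp add: field_simps)
  qed
  ultimately have "real (card \<Gamma>) + 1
      \<le> ?l / (\<epsilon> / (6 + \<epsilon>\<^sub>0)) + 4 * \<epsilon>\<^sub>0 / ln \<Delta>\<^sub>0 * (?l / \<epsilon>)"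
    using card_guesses by linarith
  also have "\<dots> = (6 + \<epsilon>\<^sub>0 + 4 * \<epsilon>\<^sub>0 / ln \<Delta>\<^sub>0) * (?l / \<epsilon>)"
    using eps_pos pos by (simp add: field_simps)
  finally show ?thesis .
qed

section \<open>From a single guess to the whole update\<close>

lemma update_cost:
  assumes "1 < \<Delta>\<^sub>0" "\<epsilon> \<le> \<epsilon>\<^sub>0" "\<Delta>\<^sub>0 \<le> aspect_ratio"
    and "H_ordered H" "p \<in> X" "run {q \<in> X. t_arr q < t_arr p} \<sigma>" "(\<sigma>', c) \<in> update p \<sigma>"
  shows "real c \<le> 322 * (6 + \<epsilon>\<^sub>0 + 4 * \<epsilon>\<^sub>0 / ln \<Delta>\<^sub>0) * (ln aspect_ratio / \<epsilon>)
           * real (min (k + H) (card (active (t_arr p))))"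
proof -
  define m where "m = min (k + H) (card (active (t_arr p)))"
  have "p \<in> active (t_arr p)" "finite (active (t_arr p))"
    using assms(5) arr_less_del X_finite by (simp_all add: active_def)
  then have "0 < card (active (t_arr p))" using card_gt_0_iff by blast
  then have m: "1 \<le> m" using k_pos by (simp add: m_def)
  have "cost_le (update p \<sigma>) ((320 * m + 2) * length (sorted_list_of_set \<Gamma>) + 1)"
    unfolding update_def m_def
    by (rule cost_le_update_guesses) (use cost_le_run_update_guess assms in auto)
  then have "c \<le> (320 * m + 2) * card \<Gamma> + 1"
    using assms(7) by (auto simp: cost_le_def)
  \<comment> \<open>Since \<open>m\<close> is at least 1, the 2 operations per guess and the final
    one fit into multiples of \<open>m\<close>.\<close>
  also have "\<dots> \<le> (322 * m) * card \<Gamma> + 322 * m"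
    using m by (intro add_mono mult_right_mono) auto
  finally have "real c \<le> real (322 * m * card \<Gamma> + 322 * m)" by (simp only: of_nat_le_iff)
  also have "\<dots> = 322 * real m * (real (card \<Gamma>) + 1)" by (simp add: algebra_simps)
  also have "\<dots> \<le> 322 * real m * ((6 + \<epsilon>\<^sub>0 + 4 * \<epsilon>\<^sub>0 / ln \<Delta>\<^sub>0) * (ln aspect_ratio / \<epsilon>))"
    using card_guesses_le[OF assms(1-3)] by (intro mult_left_mono) auto
  finally show ?thesis by (simp only: m_def mult_ac)
qed

end

text \<open>The constant depends only on the two thresholds and is chosen before the space, the
  input, \<open>k\<close>, \<open>H\<close> and the arbitrary choices. The aspect ratio is kept away
  from 1 because its logarithm vanishes there while the cost does not; \<epsilon> is bounded because
  a large \<epsilon> would likewise make the quotient arbitrarily small.\<close>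

theorem theorem4p5:
  fixes \<epsilon>\<^sub>0 \<Delta>\<^sub>0 :: real
  assumes "\<epsilon>\<^sub>0 > 0" and "\<Delta>\<^sub>0 > 1"
  shows "\<exists>C > 0. \<forall>(U :: 'a set) d X t_arr t_del k \<epsilon> H p \<sigma> \<sigma>' c.
    algorithm_B U d X t_arr t_del k \<epsilon> \<longrightarrow>
    \<epsilon> \<le> \<epsilon>\<^sub>0 \<longrightarrow>
    \<Delta>\<^sub>0 \<le> timed_points.aspect_ratio d X \<longrightarrow>
    timed_points.H_ordered X t_arr t_del H \<longrightarrow>
    p \<in> X \<longrightarrow>
    algorithm_B.run d X t_arr t_del k \<epsilon> {q \<in> X. t_arr q < t_arr p} \<sigma> \<longrightarrow>
    (\<sigma>', c) \<in> algorithm_B.update d X t_arr t_del k \<epsilon> p \<sigma> \<longrightarrow>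
    real c \<le> C * (ln (timed_points.aspect_ratio d X) / \<epsilon>)
                * real (min (k + H) (card (timed_points.active X t_arr t_del (t_arr p))))"
proof (intro exI conjI allI impI)
  \<comment> \<open>This goal also instantiates the schematic witness with the constant of
    \<open>update_cost\<close>.\<close>
  show "0 < 322 * (6 + \<epsilon>\<^sub>0 + 4 * \<epsilon>\<^sub>0 / ln \<Delta>\<^sub>0)"
    using assms by (simp add: add_pos_nonneg)
qed (rule algorithm_B.update_cost[OF _ assms(2)])

end
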